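(* Let $K$ be a field and let $M=(\{W_v\}_{v\in V},\{f_e\}_{e\in E})$ be a commutative $G$-module over $K$ such that the underlying directed acyclic graph $G=(V,E)$ has $n$ sources $s_1,\dots,s_n$ and $m$ sinks $t_1,\dots,t_m$. Let $W_{s_1},\dots,W_{s_n}$ represent the source nodes in the commutative $G$-module representation, and let $\underline{M}\subseteq\lim(M)$ be the submodule $\underline{M}=\delta^{-1}\big(\prod_{i=1}^n W_{s_i}\big)$, where $\delta:\lim(M)\to\prod_{i=1}^n W_{s_i}$ is the morphism induced by the limit cone. Then the persistence $P(M)$ of the $G$-module is obtained by evaluating the preradical $\alpha_{\underline{M}}^{\lim(M)}$ at $\operatorname{colim}(M)$: $$P(M)=\alpha_{\underline{M}}^{\lim(M)}(\operatorname{colim}(M))=\sum\big\{\,f(\underline{M})\ \big|\ f:\lim(M)\to\operatorname{colim}(M)\,\big\},$$ where the morphisms $f:\lim(M)\to\operatorname{colim}(M)$ considered in the description of the preradical $\alpha_{\underline{M}}^{\lim(M)}$ are taken within the extended $G$-module representation by the limit and the colimit of $M$.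
   Context: A directed acyclic graph (DAG) is a directed graph without directed cycles and without repeated edges. A source is a vertex with no incoming edge; a sink is a vertex with no outgoing edge. Commutative $G$-module: for a DAG $G=(V,E)$ and a field $K$, a commutative $G$-module $M=(\{W_v\}_{v\in V},\{f_e\}_{e\in E})$ assigns to each vertex $v$ a $K$-vector space $W_v$ and to each edge $e=(u,v)$ (from $u$ to $v$) a $K$-linear map $f_e:W_u\to W_v$, such that the resulting diagrams commute: writing $f_\gamma=f_{e_r}\circ\cdots\circ f_{e_1}$ for a directed path $\gamma=e_1,\dots,e_r$, one has $f_\gamma=f_{\gamma'}$ for any two directed paths $\gamma,\gamma'$ connecting the same vertices $u$ and $v$. $M$ is viewed as a diagram in the category $K$-Mod of $K$-modules, and limits and colimits are taken there. Limit, colimit, persistence: $(\lim(M),\{\eta_v\}_{v\in V})$ denotes the limit cone of $M$, with $\eta_v:\lim(M)\to W_v$, and $(\operatorname{colim}(M),\{\iota_v\}_{v\in V})$ denotes the colimit cocone, with $\iota_v:W_v\to\operatorname{colim}(M)$. The persistence of $M$ is $P(M)=\varphi_M(\lim(M))$, the image of the induced morphism $\varphi_M:\lim(M)\to\operatorname{colim}(M)$ (obtained by composing the legs $\iota_v\circ\eta_v$). The submodule $\underline{M}$: let $\rho_{s_i}:\prod_{j=1}^n W_{s_j}\to W_{s_i}$ be the projections. By the universal property of the product there is a unique morphism $\delta:\lim(M)\to\prod_{i=1}^n W_{s_i}$ with $\rho_{s_i}\circ\delta=\eta_{s_i}$ for all $i\in\{1,\dots,n\}$, and $\underline{M}:=\delta^{-1}\big(\prod_{i=1}^n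 W_{s_i}\big)$. Extended representation: the single-source single-sink diagram obtained from $M$ by adjoining $\lim(M)$ together with the morphisms $\eta_{s_i}:\lim(M)\to W_{s_i}$ ($i=1,\dots,n$) and $\operatorname{colim}(M)$ together with the morphisms $\iota_{t_j}:W_{t_j}\to\operatorname{colim}(M)$ ($j=1,\dots,m$). Morphisms $\lim(M)\to\operatorname{colim}(M)$ within it are the composites along its directed paths, i.e. $\iota_{t_j}\circ f_\gamma\circ\eta_{s_i}$ with $\gamma$ a directed path in $G$ from $s_i$ to $t_j$ ($f_\gamma$ being the identity for a trivial path). Preradical $\alpha$: a preradical on $K$-Mod is a functor $\sigma$ assigning to each object $C$ a subobject $\sigma(C)$ such that every morphism $f:C\to C'$ restricts to $\sigma(f)=f|_{\sigma(C)}:\sigma(C)\to\sigma(C')$. For a $K$-module $A$ and a submodule $N\subseteq A$, the preradical $\alpha_N^A$ is given by $\alpha_N^A(W)=\sum\{f(N)\mid f\in\operatorname{Hom}(A,W)\}$; in this statement the set of morphisms is restricted as specified in the claim.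
   Formalization: The graph G is taken to be finite, and the induced morphism from lim(M) to colim(M) is assumed to exist, i.e. the composites of the legs agree at all vertices (true for connected G); for two isolated vertices it is undefined. *)

theory Defs
  imports "Graph_Theory.Graph_Theory" "HOL-Algebra.AbelCoset" "HOL-Algebra.Module"
begin

section \<open>Linear maps, products, quotients and sums of modules\<close>

definition mod_hom :: "('k, 'c) ring_scheme \<Rightarrow> ('k, 'a, 'p) module_scheme \<Rightarrow>
    ('k, 'b, 'q) module_scheme \<Rightarrow> ('a \<Rightarrow> 'b) set" where
  "mod_hom K A B = {h \<in> hom (add_monoid A) (add_monoid B).
     \<forall>a\<in>carrier K. \<forall>x\<in>carrier A. h (a \<odot>\<^bsub>A\<^esub> x) = a \<odot>\<^bsub>B\<^esub> h x}"

text \<open>The record type of modules extends that of rings; a module in the sense of the locale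
  \<^locale>\<open>module\<close> does not use the fields \<open>mult\<close> and \<open>one\<close>, which are left unspecified below.\<close>

definition mod_prod :: "'i set \<Rightarrow> ('i \<Rightarrow> ('k, 'w) module) \<Rightarrow> ('k, 'i \<Rightarrow> 'w) module" where
  "mod_prod I W = \<lparr>carrier = (\<Pi>\<^sub>E i\<in>I. carrier (W i)), monoid.mult = undefined, one = undefined,
     ring.zero = (\<lambda>i\<in>I. \<zero>\<^bsub>W i\<^esub>), add = (\<lambda>x y. \<lambda>i\<in>I. x i \<oplus>\<^bsub>W i\<^esub> y i),
     smult = (\<lambda>a x. \<lambda>i\<in>I. a \<odot>\<^bsub>W i\<^esub> x i)\<rparr>"

definition mod_hull :: "('k, 'c) ring_scheme \<Rightarrow> ('k, 'a) module \<Rightarrow> 'a set \<Rightarrow> 'a set" where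
  "mod_hull K A S = \<Inter>{H. submodule H K A \<and> S \<subseteq> H}"

text \<open>Scalars act on a coset \<open>X\<close> of \<open>N\<close> by \<open>a \<cdot> X = N + aX\<close>; adding \<open>N\<close> is
  only needed for \<open>a = 0\<close>.\<close>

definition mod_quot :: "('k, 'a) module \<Rightarrow> 'a set \<Rightarrow> ('k, 'a set) module" where
  "mod_quot A N = \<lparr>carrier = a_rcosets\<^bsub>A\<^esub> N, monoid.mult = undefined, one = undefined,
     ring.zero = N, add = set_add A,
     smult = (\<lambda>a X. set_add A N ((\<lambda>x. a \<odot>\<^bsub>A\<^esub> x) ` X))\<rparr>"

text \<open>The sum of a family of submodules: all finite sums of elements of its members.\<close>

definition mod_sum :: "('k, 'a) module \<Rightarrow> 'a set set \<Rightarrow> 'a set" where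
  "mod_sum A \<S> = {finsum A g F | F g. finite F \<and> F \<subseteq> \<S> \<and> (\<forall>U\<in>F. g U \<in> U)}"

text \<open>The preradical \<open>\<alpha>\<^sub>N\<^sup>A\<close> evaluated at \<open>B\<close>, with the morphisms restricted to the set
  \<open>H\<close>. The unrestricted preradical is the case \<open>H = UNIV\<close>.\<close>

definition alpha :: "('k, 'c) ring_scheme \<Rightarrow> ('a \<Rightarrow> 'b) set \<Rightarrow> ('k, 'a) module \<Rightarrow> 'a set \<Rightarrow>
    ('k, 'b) module \<Rightarrow> 'b set" where
  "alpha K H A N B = mod_sum B {h ` N | h. h \<in> mod_hom K A B \<inter> H}"


section \<open>Commutative modules over a directed acyclic graph\<close>

locale dag = fin_digraph G + nomulti_digraph G for G :: "('v, 'e) pre_digraph" +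
  assumes acyclic: "\<not> cycle p"

definition sources :: "('v, 'e) pre_digraph \<Rightarrow> 'v set" where
  "sources G = {v \<in> verts G. in_arcs G v = {}}"

definition sinks :: "('v, 'e) pre_digraph \<Rightarrow> 'v set" where
  "sinks G = {v \<in> verts G. out_arcs G v = {}}"

abbreviation path_map :: "('e \<Rightarrow> 'w \<Rightarrow> 'w) \<Rightarrow> 'e list \<Rightarrow> 'w \<Rightarrow> 'w" where
  "path_map f p \<equiv> fold f p"

text \<open>The spaces \<open>W v\<close> are unrelated module structures; only the type of their elements is shared.\<close>

locale commutative_G_module = K: field K + dag G
  for K :: "('k, 'c) ring_scheme" and G :: "('v, 'e) pre_digraph" +
  fixes W :: "'v \<Rightarrow> ('k, 'w) module" and f :: "'e \<Rightarrow> 'w \<Rightarrow> 'w"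
  assumes space_module: "v \<in> verts G \<Longrightarrow> module K (W v)"
    and map_hom: "e \<in> arcs G \<Longrightarrow> f e \<in> mod_hom K (W (tail G e)) (W (head G e))"
    and commutes: "\<lbrakk>awalk u p v; awalk u q v; x \<in> carrier (W u)\<rbrakk>
      \<Longrightarrow> path_map f p x = path_map f q x"


section \<open>Limit, colimit and persistence\<close>

text \<open>The limit is the module of compatible families.\<close>

definition lim_mod :: "('v, 'e) pre_digraph \<Rightarrow> ('v \<Rightarrow> ('k, 'w) module) \<Rightarrow> ('e \<Rightarrow> 'w \<Rightarrow> 'w) \<Rightarrow>
    ('k, 'v \<Rightarrow> 'w) module" where
  "lim_mod G W f = (mod_prod (verts G) W)
     \<lparr>carrier := {x \<in> carrier (mod_prod (verts G) W). \<forall>e\<in>arcs G. f e (x (tail G e)) = x (head G e)}\<rparr>"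

definition lim_leg :: "'v \<Rightarrow> ('v \<Rightarrow> 'w) \<Rightarrow> 'w" where
  "lim_leg v x = x v"

text \<open>The colimit is the quotient of the direct sum of all \<open>W v\<close> by the relations
  \<open>x = f e x\<close>. As graphs are finite, the direct sum is the product.\<close>

definition mod_inj :: "'i set \<Rightarrow> ('i \<Rightarrow> ('k, 'w) module) \<Rightarrow> 'i \<Rightarrow> 'w \<Rightarrow> 'i \<Rightarrow> 'w" where
  "mod_inj I W v x = (\<lambda>i\<in>I. if i = v then x else \<zero>\<^bsub>W i\<^esub>)"

definition colim_rel :: "('k, 'c) ring_scheme \<Rightarrow> ('v, 'e) pre_digraph \<Rightarrow>
    ('v \<Rightarrow> ('k, 'w) module) \<Rightarrow> ('e \<Rightarrow> 'w \<Rightarrow> 'w) \<Rightarrow> ('v \<Rightarrow> 'w) set" where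
  "colim_rel K G W f = mod_hull K (mod_prod (verts G) W)
     {mod_inj (verts G) W (tail G e) x
        \<ominus>\<^bsub>mod_prod (verts G) W\<^esub> mod_inj (verts G) W (head G e) (f e x)
      | e x. e \<in> arcs G \<and> x \<in> carrier (W (tail G e))}"

definition colim_mod :: "('k, 'c) ring_scheme \<Rightarrow> ('v, 'e) pre_digraph \<Rightarrow>
    ('v \<Rightarrow> ('k, 'w) module) \<Rightarrow> ('e \<Rightarrow> 'w \<Rightarrow> 'w) \<Rightarrow> ('k, ('v \<Rightarrow> 'w) set) module" where
  "colim_mod K G W f = mod_quot (mod_prod (verts G) W) (colim_rel K G W f)"

definition colim_leg :: "('k, 'c) ring_scheme \<Rightarrow> ('v, 'e) pre_digraph \<Rightarrow>
    ('v \<Rightarrow> ('k, 'w) module) \<Rightarrow> ('e \<Rightarrow> 'w \<Rightarrow> 'w) \<Rightarrow> 'v \<Rightarrow> 'w \<Rightarrow> ('v \<Rightarrow> 'w) set" where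
  "colim_leg K G W f v x = colim_rel K G W f +>\<^bsub>mod_prod (verts G) W\<^esub> mod_inj (verts G) W v x"

text \<open>The morphism from the limit to the colimit exists only if the composites of the legs do
  not depend on the vertex, as for connected graphs (see \<open>connected_imp_induced_morphism\<close>).
  Linearity determines it on the empty graph, extensionality outside the carrier.\<close>

definition induced_morphism :: "('k, 'c) ring_scheme \<Rightarrow> ('v, 'e) pre_digraph \<Rightarrow>
    ('v \<Rightarrow> ('k, 'w) module) \<Rightarrow> ('e \<Rightarrow> 'w \<Rightarrow> 'w) \<Rightarrow> (('v \<Rightarrow> 'w) \<Rightarrow> ('v \<Rightarrow> 'w) set) \<Rightarrow> bool" where
  "induced_morphism K G W f \<phi> \<longleftrightarrow>
     \<phi> \<in> mod_hom K (lim_mod G W f) (colim_mod K G W f) \<and>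
     \<phi> \<in> extensional (carrier (lim_mod G W f)) \<and>
     (\<forall>v\<in>verts G. \<forall>x\<in>carrier (lim_mod G W f). \<phi> x = colim_leg K G W f v (lim_leg v x))"

definition persistence :: "('k, 'c) ring_scheme \<Rightarrow> ('v, 'e) pre_digraph \<Rightarrow>
    ('v \<Rightarrow> ('k, 'w) module) \<Rightarrow> ('e \<Rightarrow> 'w \<Rightarrow> 'w) \<Rightarrow> ('v \<Rightarrow> 'w) set set" where
  "persistence K G W f = (THE \<phi>. induced_morphism K G W f \<phi>) ` carrier (lim_mod G W f)"

definition source_delta :: "('v, 'e) pre_digraph \<Rightarrow> ('v \<Rightarrow> 'w) \<Rightarrow> 'v \<Rightarrow> 'w" where
  "source_delta G x = (\<lambda>s\<in>sources G. lim_leg s x)"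

definition underline_mod :: "('v, 'e) pre_digraph \<Rightarrow> ('v \<Rightarrow> ('k, 'w) module) \<Rightarrow>
    ('e \<Rightarrow> 'w \<Rightarrow> 'w) \<Rightarrow> ('v \<Rightarrow> 'w) set" where
  "underline_mod G W f =
     {x \<in> carrier (lim_mod G W f). source_delta G x \<in> carrier (mod_prod (sources G) W)}"

text \<open>The morphisms from the limit to the colimit in the extended representation, in which the
  limit has an edge to every source and every sink has an edge to the colimit.\<close>

definition extended_morphisms :: "('k, 'c) ring_scheme \<Rightarrow> ('v, 'e) pre_digraph \<Rightarrow>
    ('v \<Rightarrow> ('k, 'w) module) \<Rightarrow> ('e \<Rightarrow> 'w \<Rightarrow> 'w) \<Rightarrow> (('v \<Rightarrow> 'w) \<Rightarrow> ('v \<Rightarrow> 'w) set) set" where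
  "extended_morphisms K G W f = {colim_leg K G W f t \<circ> path_map f p \<circ> lim_leg s | s t p.
     s \<in> sources G \<and> t \<in> sinks G \<and> pre_digraph.awalk G s p t}"


section \<open>Universal properties\<close>

lemma mod_homI:
  assumes "\<And>x. x \<in> carrier A \<Longrightarrow> h x \<in> carrier B"
    and "\<And>x y. \<lbrakk>x \<in> carrier A; y \<in> carrier A\<rbrakk> \<Longrightarrow> h (x \<oplus>\<^bsub>A\<^esub> y) = h x \<oplus>\<^bsub>B\<^esub> h y"
    and "\<And>a x. \<lbrakk>a \<in> carrier K; x \<in> carrier A\<rbrakk> \<Longrightarrow> h (a \<odot>\<^bsub>A\<^esub> x) = a \<odot>\<^bsub>B\<^esub> h x"
  shows "h \<in> mod_hom K A B"
  using assms by (auto simp: mod_hom_def hom_def)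

lemma mod_homD:
  assumes "h \<in> mod_hom K A B"
  shows "x \<in> carrier A \<Longrightarrow> h x \<in> carrier B"
    and "\<lbrakk>x \<in> carrier A; y \<in> carrier A\<rbrakk> \<Longrightarrow> h (x \<oplus>\<^bsub>A\<^esub> y) = h x \<oplus>\<^bsub>B\<^esub> h y"
    and "\<lbrakk>a \<in> carrier K; x \<in> carrier A\<rbrakk> \<Longrightarrow> h (a \<odot>\<^bsub>A\<^esub> x) = a \<odot>\<^bsub>B\<^esub> h x"
  using assms by (auto simp: mod_hom_def hom_def)

lemma mod_hom_comp:
  assumes "h \<in> mod_hom K A B" "g \<in> mod_hom K B C"
  shows "g \<circ> h \<in> mod_hom K A C"
  by (rule mod_homI) (auto simp: mod_homD[OF assms(1)] mod_homD[OF assms(2)])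

lemma mod_hom_abelian_group_hom:
  assumes "h \<in> mod_hom K A B" "module K A" "module K B"
  shows "abelian_group_hom A B h"
  using assms
  by (intro abelian_group_homI group_hom.intro group_hom_axioms.intro
      abelian_group.a_group module.axioms) (auto simp: mod_hom_def)

lemmas mod_hom_zero = abelian_group_hom.hom_zero[OF mod_hom_abelian_group_hom]

lemma module_moduleI:
  assumes "cring K"
    and "\<And>x y. \<lbrakk>x \<in> carrier A; y \<in> carrier A\<rbrakk> \<Longrightarrow> x \<oplus>\<^bsub>A\<^esub> y \<in> carrier A"
    and "\<zero>\<^bsub>A\<^esub> \<in> carrier A"
    and "\<And>x y z. \<lbrakk>x \<in> carrier A; y \<in> carrier A; z \<in> carrier A\<rbrakk>
           \<Longrightarrow> (x \<oplus>\<^bsub>A\<^esub> y) \<oplus>\<^bsub>A\<^esub> z = x \<oplus>\<^bsub>A\<^esub> (y \<oplus>\<^bsub>A\<^esub> z)"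
    and "\<And>x y. \<lbrakk>x \<in> carrier A; y \<in> carrier A\<rbrakk> \<Longrightarrow> x \<oplus>\<^bsub>A\<^esub> y = y \<oplus>\<^bsub>A\<^esub> x"
    and "\<And>x. x \<in> carrier A \<Longrightarrow> \<zero>\<^bsub>A\<^esub> \<oplus>\<^bsub>A\<^esub> x = x"
    and "\<And>x. x \<in> carrier A \<Longrightarrow> \<exists>y\<in>carrier A. y \<oplus>\<^bsub>A\<^esub> x = \<zero>\<^bsub>A\<^esub>"
    and "\<And>a x. \<lbrakk>a \<in> carrier K; x \<in> carrier A\<rbrakk> \<Longrightarrow> a \<odot>\<^bsub>A\<^esub> x \<in> carrier A"
    and "\<And>a b x. \<lbrakk>a \<in> carrier K; b \<in> carrier K; x \<in> carrier A\<rbrakk>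
           \<Longrightarrow> (a \<oplus>\<^bsub>K\<^esub> b) \<odot>\<^bsub>A\<^esub> x = a \<odot>\<^bsub>A\<^esub> x \<oplus>\<^bsub>A\<^esub> b \<odot>\<^bsub>A\<^esub> x"
    and "\<And>a x y. \<lbrakk>a \<in> carrier K; x \<in> carrier A; y \<in> carrier A\<rbrakk>
           \<Longrightarrow> a \<odot>\<^bsub>A\<^esub> (x \<oplus>\<^bsub>A\<^esub> y) = a \<odot>\<^bsub>A\<^esub> x \<oplus>\<^bsub>A\<^esub> a \<odot>\<^bsub>A\<^esub> y"
    and "\<And>a b x. \<lbrakk>a \<in> carrier K; b \<in> carrier K; x \<in> carrier A\<rbrakk>
           \<Longrightarrow> (a \<otimes>\<^bsub>K\<^esub> b) \<odot>\<^bsub>A\<^esub> x = a \<odot>\<^bsub>A\<^esub> (b \<odot>\<^bsub>A\<^esub> x)"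
    and "\<And>x. x \<in> carrier A \<Longrightarrow> \<one>\<^bsub>K\<^esub> \<odot>\<^bsub>A\<^esub> x = x"
  shows "module K A"
  by (intro moduleI abelian_groupI; (rule assms; assumption?))

lemma mod_prod_simps:
  "carrier (mod_prod I W) = (\<Pi>\<^sub>E i\<in>I. carrier (W i))"
  "\<zero>\<^bsub>mod_prod I W\<^esub> = (\<lambda>i\<in>I. \<zero>\<^bsub>W i\<^esub>)"
  "x \<oplus>\<^bsub>mod_prod I W\<^esub> y = (\<lambda>i\<in>I. x i \<oplus>\<^bsub>W i\<^esub> y i)"
  "a \<odot>\<^bsub>mod_prod I W\<^esub> x = (\<lambda>i\<in>I. a \<odot>\<^bsub>W i\<^esub> x i)"
  by (auto simp: mod_prod_def)

lemma module_mod_prod: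
  assumes "cring K" and M: "\<And>i. i \<in> I \<Longrightarrow> module K (W i)"
  shows "module K (mod_prod I W)"
proof -
  have grp: "abelian_group (W i)" if "i \<in> I" for i
    using M[OF that] by (rule module.axioms)
  note mon = abelian_group.axioms(1)[OF grp]
  note simps = mod_prod_simps PiE_iff abelian_monoid.a_closed[OF mon]
    abelian_monoid.zero_closed[OF mon] module.smult_closed[OF M]
  show ?thesis
  proof (rule module_moduleI, rule assms(1))
    fix x assume x: "x \<in> carrier (mod_prod I W)"
    show "\<exists>y\<in>carrier (mod_prod I W). y \<oplus>\<^bsub>mod_prod I W\<^esub> x = \<zero>\<^bsub>mod_prod I W\<^esub>"
      using x by (intro bexI[of _ "\<lambda>i\<in>I. \<ominus>\<^bsub>W i\<^esub> x i"])
        (auto simp: simps abelian_group.l_neg[OF grp] abelian_group.a_inv_closed[OF grp]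
          intro!: restrict_ext)
    show "\<zero>\<^bsub>mod_prod I W\<^esub> \<oplus>\<^bsub>mod_prod I W\<^esub> x = x"
      using x by (auto simp: simps abelian_monoid.l_zero[OF mon] fun_eq_iff extensional_def)
    show "\<one>\<^bsub>K\<^esub> \<odot>\<^bsub>mod_prod I W\<^esub> x = x"
      using x by (auto simp: simps module.smult_one[OF M] fun_eq_iff extensional_def)
  qed (auto simp: simps abelian_monoid.a_assoc[OF mon] module.smult_l_distr[OF M]
      module.smult_r_distr[OF M] module.smult_assoc1[OF M]
      intro!: restrict_ext intro: abelian_monoid.a_comm[OF mon])
qed

lemma mod_proj_hom:
  "i \<in> I \<Longrightarrow> (\<lambda>x. x i) \<in> mod_hom K (mod_prod I W) (W i)"
  by (rule mod_homI) (auto simp: mod_prod_simps)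

lemma submodule_mod_hull:
  assumes "module K A" "S \<subseteq> carrier A"
  shows "submodule (mod_hull K A S) K A"
proof -
  interpret module K A by fact
  have "carrier A \<in> {H. submodule H K A \<and> S \<subseteq> H}"
    using assms carrier_is_submodule by auto
  then show ?thesis
    unfolding mod_hull_def
    by (intro submoduleI) (auto dest: submoduleE(1,3,4) subgroup.one_closed[OF submodule.axioms(1)]
        intro: submoduleE(5))
qed

lemma submodule_abelian_subgroup:
  assumes "module K A" "submodule N K A"
  shows "abelian_subgroup N A"
  using assms
  by (intro abelian_subgroupI3 additive_subgroup.intro) (auto dest: module.axioms submodule.axioms)

lemma mod_quot_simps:
  "carrier (mod_quot A N) = a_rcosets\<^bsub>A\<^esub> N"
  "\<zero>\<^bsub>mod_quot A N\<^esub> = N"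
  "X \<oplus>\<^bsub>mod_quot A N\<^esub> Y = set_add A X Y"
  by (auto simp: mod_quot_def)

lemma
  assumes A: "module K A" and N: "submodule N K A"
  shows mod_quot_carrier: "carrier (mod_quot A N) = (\<lambda>x. N +>\<^bsub>A\<^esub> x) ` carrier A"
    and mod_quot_add: "\<lbrakk>x \<in> carrier A; y \<in> carrier A\<rbrakk>
      \<Longrightarrow> (N +>\<^bsub>A\<^esub> x) \<oplus>\<^bsub>mod_quot A N\<^esub> (N +>\<^bsub>A\<^esub> y) = N +>\<^bsub>A\<^esub> (x \<oplus>\<^bsub>A\<^esub> y)"
    and mod_quot_smult: "\<lbrakk>a \<in> carrier K; x \<in> carrier A\<rbrakk>
      \<Longrightarrow> a \<odot>\<^bsub>mod_quot A N\<^esub> (N +>\<^bsub>A\<^esub> x) = N +>\<^bsub>A\<^esub> (a \<odot>\<^bsub>A\<^esub> x)"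
    and module_mod_quot: "module K (mod_quot A N)"
    and mod_quot_zero: "\<zero>\<^bsub>mod_quot A N\<^esub> = N +>\<^bsub>A\<^esub> \<zero>\<^bsub>A\<^esub>"
proof -
  interpret A: module K A by fact
  interpret N: submodule N K A by fact
  interpret NA: abelian_subgroup N A by (rule submodule_abelian_subgroup[OF A N])
  have sub: "N \<subseteq> carrier A" using NA.a_subset .
  show car: "carrier (mod_quot A N) = (\<lambda>x. N +>\<^bsub>A\<^esub> x) ` carrier A"
    by (auto simp: mod_quot_simps A_RCOSETS_def' )
  show add: "(N +>\<^bsub>A\<^esub> x) \<oplus>\<^bsub>mod_quot A N\<^esub> (N +>\<^bsub>A\<^esub> y) = N +>\<^bsub>A\<^esub> (x \<oplus>\<^bsub>A\<^esub> y)"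
    if "x \<in> carrier A" "y \<in> carrier A" for x y
    using that by (simp add: mod_quot_simps NA.a_rcos_sum)
  show smult: "a \<odot>\<^bsub>mod_quot A N\<^esub> (N +>\<^bsub>A\<^esub> x) = N +>\<^bsub>A\<^esub> (a \<odot>\<^bsub>A\<^esub> x)"
    if a: "a \<in> carrier K" and x: "x \<in> carrier A" for a x
  proof -
    have "set_add A N ((\<lambda>y. a \<odot>\<^bsub>A\<^esub> y) ` (N +>\<^bsub>A\<^esub> x)) = N +>\<^bsub>A\<^esub> (a \<odot>\<^bsub>A\<^esub> x)" (is "?L = ?R")
    proof
      show "?L \<subseteq> ?R"
      proof
        fix z assume "z \<in> ?L"
        then obtain m n where mn: "m \<in> N" "n \<in> N" "z = m \<oplus>\<^bsub>A\<^esub> a \<odot>\<^bsub>A\<^esub> (n \<oplus>\<^bsub>A\<^esub> x)"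
          by (auto simp: set_add_def' a_r_coset_def')
        then have "z = (m \<oplus>\<^bsub>A\<^esub> a \<odot>\<^bsub>A\<^esub> n) \<oplus>\<^bsub>A\<^esub> a \<odot>\<^bsub>A\<^esub> x"
          using a x sub by (simp add: A.smult_r_distr A.a_assoc subset_iff)
        moreover have "m \<oplus>\<^bsub>A\<^esub> a \<odot>\<^bsub>A\<^esub> n \<in> N"
          using mn a by simp
        ultimately show "z \<in> ?R" by (auto simp: a_r_coset_def')
      qed
      show "?R \<subseteq> ?L"
      proof
        fix z assume "z \<in> ?R"
        then obtain m where m: "m \<in> N" "z = m \<oplus>\<^bsub>A\<^esub> a \<odot>\<^bsub>A\<^esub> x"
          by (auto simp: a_r_coset_def')
        moreover have "x \<in> N +>\<^bsub>A\<^esub> x" using x by (rule NA.a_rcos_self)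
        ultimately show "z \<in> ?L" by (auto simp: set_add_def')
      qed
    qed
    then show ?thesis by (simp add: mod_quot_def)
  qed
  show zero: "\<zero>\<^bsub>mod_quot A N\<^esub> = N +>\<^bsub>A\<^esub> \<zero>\<^bsub>A\<^esub>"
    using sub by (simp add: mod_quot_simps)
  show "module K (mod_quot A N)"
  proof (rule module_moduleI)
    show "cring K" ..
    fix X assume "X \<in> carrier (mod_quot A N)"
    then obtain x where x: "x \<in> carrier A" "X = N +>\<^bsub>A\<^esub> x" by (auto simp: car)
    then show "\<exists>Y\<in>carrier (mod_quot A N). Y \<oplus>\<^bsub>mod_quot A N\<^esub> X = \<zero>\<^bsub>mod_quot A N\<^esub>"
      by (intro bexI[of _ "N +>\<^bsub>A\<^esub> (\<ominus>\<^bsub>A\<^esub> x)"]) (auto simp: add car zero A.l_neg)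
  qed (auto simp: car add smult zero A.a_ac A.smult_l_distr A.smult_r_distr A.smult_assoc1)
qed

context commutative_G_module
begin

abbreviation "SumM \<equiv> mod_prod (verts G) W"
abbreviation "Rel \<equiv> colim_rel K G W f"
abbreviation "LimM \<equiv> lim_mod G W f"
abbreviation "ColimM \<equiv> colim_mod K G W f"
abbreviation "\<iota> \<equiv> colim_leg K G W f"
abbreviation "inc \<equiv> mod_inj (verts G) W"

lemma module_Sum: "module K SumM"
  by (rule module_mod_prod[OF K.is_cring space_module])

lemma map_zero: "e \<in> arcs G \<Longrightarrow> f e \<zero>\<^bsub>W (tail G e)\<^esub> = \<zero>\<^bsub>W (head G e)\<^esub>"
  by (rule mod_hom_zero[OF map_hom]) (auto intro: space_module)

lemma LimM_simps:
  "x \<in> carrier LimM \<longleftrightarrow> x \<in> carrier SumM \<and> (\<forall>e\<in>arcs G. f e (x (tail G e)) = x (head G e))"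
  "x \<oplus>\<^bsub>LimM\<^esub> y = x \<oplus>\<^bsub>SumM\<^esub> y" "a \<odot>\<^bsub>LimM\<^esub> x = a \<odot>\<^bsub>SumM\<^esub> x"
  by (auto simp: lim_mod_def)

lemma LimM_submodule: "submodule (carrier LimM) K SumM"
proof -
  interpret SumM: module K SumM by (rule module_Sum)
  have smult: "a \<odot>\<^bsub>SumM\<^esub> x \<in> carrier LimM" if "a \<in> carrier K" "x \<in> carrier LimM" for a x
    using that by (auto simp: LimM_simps mod_prod_simps PiE_iff mod_homD(3)[OF map_hom]
        module.smult_closed[OF space_module])
  show ?thesis
  proof (rule SumM.submoduleI)
    show "\<zero>\<^bsub>SumM\<^esub> \<in> carrier LimM"
      using SumM.zero_closed by (auto simp: LimM_simps mod_prod_simps(2) map_zero)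
  next
    fix x assume "x \<in> carrier LimM"
    then show "\<ominus>\<^bsub>SumM\<^esub> x \<in> carrier LimM"
      using smult[of "\<ominus>\<^bsub>K\<^esub> \<one>\<^bsub>K\<^esub>" x] by (simp add: LimM_simps(1) SumM.smult_l_minus)
  next
    fix x y assume "x \<in> carrier LimM" "y \<in> carrier LimM"
    then show "x \<oplus>\<^bsub>SumM\<^esub> y \<in> carrier LimM"
      using SumM.a_closed[of x y] by (auto simp: LimM_simps mod_homD(2)[OF map_hom])
        (auto simp: mod_prod_simps PiE_iff mod_homD(2)[OF map_hom])
  qed (use smult in \<open>simp_all add: LimM_simps(1) subset_iff\<close>)
qed

lemma module_Lim: "module K LimM"
proof -
  have "LimM = SumM\<lparr>carrier := carrier LimM\<rparr>" by (simp add: lim_mod_def)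
  then show ?thesis
    using submodule.submodule_is_module[OF LimM_submodule module_Sum] by simp
qed

lemma lim_leg_hom: "v \<in> verts G \<Longrightarrow> lim_leg v \<in> mod_hom K LimM (W v)"
  by (rule mod_homI) (auto simp: LimM_simps mod_prod_simps lim_leg_def)

lemma lim_cone: "\<lbrakk>e \<in> arcs G; x \<in> carrier LimM\<rbrakk> \<Longrightarrow> f e (lim_leg (tail G e) x) = lim_leg (head G e) x"
  by (simp add: LimM_simps lim_leg_def)

theorem lim_universal:
  assumes N: "module K N"
    and \<psi>: "\<And>v. v \<in> verts G \<Longrightarrow> \<psi> v \<in> mod_hom K N (W v)"
    and cone: "\<And>e x. \<lbrakk>e \<in> arcs G; x \<in> carrier N\<rbrakk> \<Longrightarrow> f e (\<psi> (tail G e) x) = \<psi> (head G e) x"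
  shows "\<exists>!u. u \<in> mod_hom K N LimM \<and> u \<in> extensional (carrier N) \<and>
    (\<forall>v\<in>verts G. \<forall>x\<in>carrier N. lim_leg v (u x) = \<psi> v x)"
proof (rule ex1I)
  interpret N: module K N by fact
  let ?u = "\<lambda>x\<in>carrier N. \<lambda>v\<in>verts G. \<psi> v x"
  have "?u \<in> mod_hom K N LimM"
    by (rule mod_homI) (auto simp: LimM_simps mod_prod_simps cone mod_homD[OF \<psi>] intro!: restrict_ext)
  then show "?u \<in> mod_hom K N LimM \<and> ?u \<in> extensional (carrier N) \<and>
      (\<forall>v\<in>verts G. \<forall>x\<in>carrier N. lim_leg v (?u x) = \<psi> v x)"
    by (simp add: lim_leg_def)
  fix u assume u: "u \<in> mod_hom K N LimM \<and> u \<in> extensional (carrier N) \<and>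
      (\<forall>v\<in>verts G. \<forall>x\<in>carrier N. lim_leg v (u x) = \<psi> v x)"
  show "u = ?u"
  proof (rule extensionalityI[of _ "carrier N"])
    fix x assume x: "x \<in> carrier N"
    then have "u x \<in> extensional (verts G)"
      using u mod_homD(1)[of u K N LimM x] by (auto simp: LimM_simps mod_prod_simps PiE_def)
    then show "u x = ?u x"
      using u x by (intro extensionalityI[of _ "verts G"]) (auto simp: lim_leg_def)
  qed (use u in auto)
qed

theorem source_delta_universal:
  "\<exists>!\<delta>. \<delta> \<in> mod_hom K LimM (mod_prod (sources G) W) \<and> \<delta> \<in> extensional (carrier LimM) \<and>
    (\<forall>s\<in>sources G. \<forall>x\<in>carrier LimM. \<delta> x s = lim_leg s x)" (is ?ex1)
  "restrict (source_delta G) (carrier LimM) \<in> mod_hom K LimM (mod_prod (sources G) W)" (is ?hom)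
  "\<lbrakk>s \<in> sources G; x \<in> carrier LimM\<rbrakk> \<Longrightarrow> source_delta G x s = lim_leg s x"
proof -
  interpret LimM: module K LimM by (rule module_Lim)
  have leg: "lim_leg s \<in> mod_hom K LimM (W s)" if "s \<in> sources G" for s
    using that by (intro lim_leg_hom) (simp add: sources_def)
  show hom: ?hom
    by (rule mod_homI) (auto simp: mod_prod_simps source_delta_def mod_homD[OF leg] intro!: restrict_ext)
  show eq: "source_delta G x s = lim_leg s x" if "s \<in> sources G" "x \<in> carrier LimM" for s x
    using that by (simp add: source_delta_def)
  show ?ex1
  proof (rule ex1I)
    show "restrict (source_delta G) (carrier LimM) \<in> mod_hom K LimM (mod_prod (sources G) W) \<and>
      restrict (source_delta G) (carrier LimM) \<in> extensional (carrier LimM) \<and>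
      (\<forall>s\<in>sources G. \<forall>x\<in>carrier LimM. restrict (source_delta G) (carrier LimM) x s = lim_leg s x)"
      using hom eq by simp
    fix \<delta> assume \<delta>: "\<delta> \<in> mod_hom K LimM (mod_prod (sources G) W) \<and> \<delta> \<in> extensional (carrier LimM) \<and>
      (\<forall>s\<in>sources G. \<forall>x\<in>carrier LimM. \<delta> x s = lim_leg s x)"
    show "\<delta> = restrict (source_delta G) (carrier LimM)"
    proof (rule extensionalityI[of _ "carrier LimM"])
      fix x assume x: "x \<in> carrier LimM"
      then have "\<delta> x \<in> extensional (sources G)"
        using \<delta> mod_homD(1)[of \<delta> K LimM "mod_prod (sources G) W" x]
        by (auto simp: mod_prod_simps PiE_def)
      then show "\<delta> x = restrict (source_delta G) (carrier LimM) x"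
        using \<delta> x by (intro extensionalityI[of _ "sources G"]) (auto simp: source_delta_def)
    qed (use \<delta> in auto)
  qed
qed

lemma inc_hom:
  assumes "v \<in> verts G" shows "inc v \<in> mod_hom K (W v) SumM"
proof -
  have zero: "\<zero>\<^bsub>W w\<^esub> \<oplus>\<^bsub>W w\<^esub> \<zero>\<^bsub>W w\<^esub> = \<zero>\<^bsub>W w\<^esub>" "\<zero>\<^bsub>W w\<^esub> \<in> carrier (W w)"
    "a \<in> carrier K \<Longrightarrow> a \<odot>\<^bsub>W w\<^esub> \<zero>\<^bsub>W w\<^esub> = \<zero>\<^bsub>W w\<^esub>" if "w \<in> verts G" for w a
  proof -
    interpret module K "W w" by (rule space_module[OF that])
    show "\<zero>\<^bsub>W w\<^esub> \<oplus>\<^bsub>W w\<^esub> \<zero>\<^bsub>W w\<^esub> = \<zero>\<^bsub>W w\<^esub>" "\<zero>\<^bsub>W w\<^esub> \<in> carrier (W w)"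
      "a \<in> carrier K \<Longrightarrow> a \<odot>\<^bsub>W w\<^esub> \<zero>\<^bsub>W w\<^esub> = \<zero>\<^bsub>W w\<^esub>" by simp_all
  qed
  show ?thesis
    by (rule mod_homI) (auto simp: mod_prod_simps mod_inj_def zero intro!: restrict_ext)
qed

lemma Rel_gens:
  "{inc (tail G e) x \<ominus>\<^bsub>SumM\<^esub> inc (head G e) (f e x) | e x. e \<in> arcs G \<and> x \<in> carrier (W (tail G e))}
    \<subseteq> carrier SumM"
proof -
  interpret SumM: module K SumM by (rule module_Sum)
  show ?thesis
    by (auto intro!: SumM.minus_closed mod_homD(1)[OF inc_hom] mod_homD(1)[OF map_hom])
qed

lemma Rel_submodule: "submodule Rel K SumM"
  unfolding colim_rel_def by (rule submodule_mod_hull[OF module_Sum Rel_gens])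

lemma module_Colim: "module K ColimM"
  unfolding colim_mod_def by (rule module_mod_quot[OF module_Sum Rel_submodule])

lemma quot_hom: "(\<lambda>x. Rel +>\<^bsub>SumM\<^esub> x) \<in> mod_hom K SumM ColimM"
  unfolding colim_mod_def
  using module_Sum Rel_submodule
  by (intro mod_homI) (auto simp: mod_quot_carrier mod_quot_add mod_quot_smult)

lemma colim_leg_hom: "v \<in> verts G \<Longrightarrow> \<iota> v \<in> mod_hom K (W v) ColimM"
  using mod_hom_comp[OF inc_hom quot_hom] by (simp add: colim_leg_def[abs_def] comp_def)

lemma colim_cocone:
  assumes e: "e \<in> arcs G" and x: "x \<in> carrier (W (tail G e))"
  shows "\<iota> (head G e) (f e x) = \<iota> (tail G e) x"
proof -
  interpret SumM: module K SumM by (rule module_Sum)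
  interpret R: abelian_subgroup Rel SumM
    by (rule submodule_abelian_subgroup[OF module_Sum Rel_submodule])
  have car: "inc (tail G e) x \<in> carrier SumM" "inc (head G e) (f e x) \<in> carrier SumM"
    using e x by (auto intro!: mod_homD(1)[OF inc_hom] mod_homD(1)[OF map_hom])
  have "inc (tail G e) x \<ominus>\<^bsub>SumM\<^esub> inc (head G e) (f e x) \<in> Rel"
    unfolding colim_rel_def mod_hull_def using e x by blast
  then have "inc (tail G e) x \<in> Rel +>\<^bsub>SumM\<^esub> inc (head G e) (f e x)"
    using car by (simp add: R.a_rcos_module a_minus_def)
  then show ?thesis
    unfolding colim_leg_def by (rule R.a_repr_independence'[OF _ car(2)])
qed

lemma Sum_hom_ext:
  assumes N: "module K N" and g: "g \<in> mod_hom K SumM N" and h: "h \<in> mod_hom K SumM N"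
    and eq: "\<And>v x. \<lbrakk>v \<in> verts G; x \<in> carrier (W v)\<rbrakk> \<Longrightarrow> g (inc v x) = h (inc v x)"
    and x: "x \<in> carrier SumM"
  shows "g x = h x"
proof -
  have "g x = h x" if "finite S" "S \<subseteq> verts G" "x \<in> carrier SumM" "\<And>v. v \<in> verts G - S \<Longrightarrow> x v = \<zero>\<^bsub>W v\<^esub>" for S x
    using that
  proof (induction S arbitrary: x rule: finite_induct)
    case empty
    then have "x = \<zero>\<^bsub>SumM\<^esub>"
      by (intro extensionalityI[of _ "verts G"]) (auto simp: mod_prod_simps PiE_def)
    then show ?case
      using mod_hom_zero[OF g module_Sum N] mod_hom_zero[OF h module_Sum N] by simp
  next
    case (insert v S)
    have mon: "abelian_monoid (W w)" if "w \<in> verts G" for w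
      using space_module[OF that] by (intro abelian_group.axioms module.axioms)
    note simps = mod_prod_simps PiE_iff mod_inj_def abelian_monoid.zero_closed[OF mon]
      abelian_monoid.l_zero[OF mon] abelian_monoid.r_zero[OF mon]
    let ?y = "\<lambda>w\<in>verts G. if w = v then \<zero>\<^bsub>W w\<^esub> else x w"
    have v: "v \<in> verts G" using insert.prems by simp
    have y: "?y \<in> carrier SumM" and xv: "x v \<in> carrier (W v)"
      using insert.prems v by (auto simp: simps)
    have x_eq: "x = inc v (x v) \<oplus>\<^bsub>SumM\<^esub> ?y"
      using insert.prems by (intro extensionalityI[of _ "verts G"])
        (auto simp: simps)
    have gh: "g ?y = h ?y"
    proof (rule insert.IH[OF _ y])
      show "S \<subseteq> verts G" using insert.prems(1) by simp
      show "?y w = \<zero>\<^bsub>W w\<^esub>" if "w \<in> verts G - S" for w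
        using that insert.prems(3)[of w] by simp
    qed
    have "g x = g (inc v (x v)) \<oplus>\<^bsub>N\<^esub> g ?y"
      by (subst x_eq) (rule mod_homD(2)[OF g mod_homD(1)[OF inc_hom[OF v] xv] y])
    also have "\<dots> = h (inc v (x v)) \<oplus>\<^bsub>N\<^esub> h ?y"
      by (simp only: gh eq[OF v xv])
    also have "\<dots> = h x"
      by (subst (3) x_eq) (rule mod_homD(2)[OF h mod_homD(1)[OF inc_hom[OF v] xv] y, symmetric])
    finally show ?case .
  qed
  from this[of "verts G" x] x show ?thesis by simp
qed

theorem colim_universal:
  assumes N: "module K N"
    and \<theta>: "\<And>v. v \<in> verts G \<Longrightarrow> \<theta> v \<in> mod_hom K (W v) N"
    and cocone: "\<And>e x. \<lbrakk>e \<in> arcs G; x \<in> carrier (W (tail G e))\<rbrakk>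
      \<Longrightarrow> \<theta> (head G e) (f e x) = \<theta> (tail G e) x"
  shows "\<exists>!u. u \<in> mod_hom K ColimM N \<and> u \<in> extensional (carrier ColimM) \<and>
    (\<forall>v\<in>verts G. \<forall>x\<in>carrier (W v). u (\<iota> v x) = \<theta> v x)"
proof -
  interpret N: module K N by fact
  interpret SumM: module K SumM by (rule module_Sum)
  interpret R: abelian_subgroup Rel SumM
    by (rule submodule_abelian_subgroup[OF module_Sum Rel_submodule])
  have car: "carrier ColimM = (\<lambda>x. Rel +>\<^bsub>SumM\<^esub> x) ` carrier SumM"
    unfolding colim_mod_def by (rule mod_quot_carrier[OF module_Sum Rel_submodule])
  define h where "h x = (\<Oplus>\<^bsub>N\<^esub>v\<in>verts G. \<theta> v (x v))" for x
  have clo: "\<theta> v (x v) \<in> carrier N" if "x \<in> carrier SumM" "v \<in> verts G" for x v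
    using that by (auto simp: mod_prod_simps intro!: mod_homD(1)[OF \<theta>])
  have h: "h \<in> mod_hom K SumM N"
  proof (rule mod_homI)
    fix x y assume xy: "x \<in> carrier SumM" "y \<in> carrier SumM"
    have "h (x \<oplus>\<^bsub>SumM\<^esub> y) = (\<Oplus>\<^bsub>N\<^esub>v\<in>verts G. \<theta> v (x v) \<oplus>\<^bsub>N\<^esub> \<theta> v (y v))"
      unfolding h_def using xy
      by (intro N.finsum_cong') (auto simp: clo mod_prod_simps PiE_iff mod_homD[OF \<theta>])
    then show "h (x \<oplus>\<^bsub>SumM\<^esub> y) = h x \<oplus>\<^bsub>N\<^esub> h y"
      using xy clo by (simp add: h_def N.finsum_addf)
  next
    fix a x assume ax: "a \<in> carrier K" "x \<in> carrier SumM"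
    have "h (a \<odot>\<^bsub>SumM\<^esub> x) = (\<Oplus>\<^bsub>N\<^esub>v\<in>verts G. a \<odot>\<^bsub>N\<^esub> \<theta> v (x v))"
      unfolding h_def using ax
      by (intro N.finsum_cong') (auto simp: clo mod_prod_simps PiE_iff mod_homD[OF \<theta>])
    then show "h (a \<odot>\<^bsub>SumM\<^esub> x) = a \<odot>\<^bsub>N\<^esub> h x"
      using ax clo by (simp add: h_def N.finsum_smult_ldistr)
  qed (auto simp: h_def clo intro!: N.finsum_closed)
  interpret h: abelian_group_hom SumM N h by (rule mod_hom_abelian_group_hom[OF h module_Sum N])
  have h_inc: "h (inc v x) = \<theta> v x" if "v \<in> verts G" "x \<in> carrier (W v)" for v x
  proof -
    have "h (inc v x) = (\<Oplus>\<^bsub>N\<^esub>w\<in>verts G. if v = w then \<theta> v x else \<zero>\<^bsub>N\<^esub>)"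
      unfolding h_def using that
      by (intro N.finsum_cong')
        (auto simp: mod_inj_def mod_homD[OF \<theta>] mod_hom_zero[OF \<theta> space_module N])
    also have "\<dots> = \<theta> v x"
      using that N.finsum_singleton[of v "verts G" "\<lambda>w. \<theta> v x"] by (simp add: mod_homD[OF \<theta>])
    finally show ?thesis .
  qed
  have "Rel \<subseteq> a_kernel SumM N h"
  proof -
    have "submodule (a_kernel SumM N h) K SumM"
      by (intro submodule.intro submodule_axioms.intro)
        (auto simp: a_kernel_def' mod_homD(3)[OF h]
          intro: additive_subgroup.a_subgroup[OF h.additive_subgroup_a_kernel, unfolded a_kernel_def'])
    moreover have "h (inc (tail G e) x \<ominus>\<^bsub>SumM\<^esub> inc (head G e) (f e x)) = \<zero>\<^bsub>N\<^esub>"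
      if "e \<in> arcs G" "x \<in> carrier (W (tail G e))" for e x
    proof -
      have "inc (tail G e) x \<in> carrier SumM" "inc (head G e) (f e x) \<in> carrier SumM"
           "f e x \<in> carrier (W (head G e))" "\<theta> (tail G e) x \<in> carrier N"
        using that by (auto intro!: mod_homD(1)[OF inc_hom] mod_homD(1)[OF map_hom] mod_homD(1)[OF \<theta>])
      then show ?thesis
        using that by (simp add: a_minus_def h_inc cocone N.r_neg)
    qed
    ultimately show ?thesis
      unfolding colim_rel_def mod_hull_def
      by (intro Inter_lower CollectI conjI) (auto simp: a_kernel_def' intro!: subsetD[OF Rel_gens])
  qed
  then have h_coset: "h y = h x" if "x \<in> carrier SumM" "y \<in> Rel +>\<^bsub>SumM\<^esub> x" for x y
    using that by (auto simp: a_r_coset_def' a_kernel_def')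
  define u where "u = (\<lambda>X\<in>carrier ColimM. the_elem (h ` X))"
  have u: "u (Rel +>\<^bsub>SumM\<^esub> x) = h x" if "x \<in> carrier SumM" for x
  proof -
    have "h ` (Rel +>\<^bsub>SumM\<^esub> x) = {h x}"
      using that h_coset R.a_rcos_self[OF that] by blast
    then show ?thesis using that by (simp add: u_def car)
  qed
  show ?thesis
  proof (rule ex1I)
    have "u \<in> mod_hom K ColimM N"
    proof (rule mod_homI)
      fix X Y assume "X \<in> carrier ColimM" "Y \<in> carrier ColimM"
      then show "u (X \<oplus>\<^bsub>ColimM\<^esub> Y) = u X \<oplus>\<^bsub>N\<^esub> u Y"
        by (auto simp: car u mod_homD(2)[OF quot_hom, symmetric])
    next
      fix a X assume "a \<in> carrier K" "X \<in> carrier ColimM"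
      then show "u (a \<odot>\<^bsub>ColimM\<^esub> X) = a \<odot>\<^bsub>N\<^esub> u X"
        by (auto simp: car u mod_homD(3)[OF quot_hom, symmetric] mod_homD(3)[OF h])
    qed (auto simp: car u)
    moreover have "u \<in> extensional (carrier ColimM)" by (simp add: u_def)
    ultimately show "u \<in> mod_hom K ColimM N \<and> u \<in> extensional (carrier ColimM) \<and>
        (\<forall>v\<in>verts G. \<forall>x\<in>carrier (W v). u (\<iota> v x) = \<theta> v x)"
      by (auto simp: colim_leg_def u h_inc mod_homD(1)[OF inc_hom])
    fix u' assume u': "u' \<in> mod_hom K ColimM N \<and> u' \<in> extensional (carrier ColimM) \<and>
        (\<forall>v\<in>verts G. \<forall>x\<in>carrier (W v). u' (\<iota> v x) = \<theta> v x)"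
    then have hom': "u' \<circ> (\<lambda>x. Rel +>\<^bsub>SumM\<^esub> x) \<in> mod_hom K SumM N"
      using mod_hom_comp[OF quot_hom] by blast
    show "u' = u"
    proof (rule extensionalityI[of _ "carrier ColimM"])
      fix X assume "X \<in> carrier ColimM"
      then obtain x where x: "x \<in> carrier SumM" "X = Rel +>\<^bsub>SumM\<^esub> x" by (auto simp: car)
      have "(u' \<circ> (\<lambda>x. Rel +>\<^bsub>SumM\<^esub> x)) x = h x"
        using u' h_inc by (intro Sum_hom_ext[OF N hom' h _ x(1)]) (auto simp: colim_leg_def)
      then show "u' X = u X" using x u by simp
    qed (use u' in \<open>auto simp: u_def\<close>)
  qed
qed

lemma connected_imp_induced_morphism:
  assumes "connected G"
  shows "\<exists>\<phi>. induced_morphism K G W f \<phi>"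
proof -
  from assms obtain r where r: "r \<in> verts G"
    and reach: "\<And>v. v \<in> verts G \<Longrightarrow> r \<rightarrow>\<^sup>*\<^bsub>mk_symmetric G\<^esub> v"
    by (auto simp: connected_def strongly_connected_def)
  have leg_step: "\<iota> (tail G e) (lim_leg (tail G e) x) = \<iota> (head G e) (lim_leg (head G e) x)"
    if "e \<in> arcs G" "x \<in> carrier LimM" for e x
    using that colim_cocone[OF that(1), of "lim_leg (tail G e) x"]
      mod_homD(1)[OF lim_leg_hom] by (simp add: lim_cone)
  have eq: "\<iota> r (lim_leg r x) = \<iota> v (lim_leg v x)" if v: "v \<in> verts G" and x: "x \<in> carrier LimM" for v x
    using reach[OF v] unfolding reachable_def
  proof (induction rule: rtrancl_on_induct)
    case (step y z)
    then obtain e where "e \<in> arcs G"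
      "y = tail G e \<and> z = head G e \<or> y = head G e \<and> z = tail G e"
      by (auto simp: parcs_mk_symmetric)
    then show ?case using step x leg_step by metis
  qed simp
  have "restrict (\<iota> r \<circ> lim_leg r) (carrier LimM) \<in> mod_hom K LimM ColimM"
    using mod_hom_comp[OF lim_leg_hom[OF r] colim_leg_hom[OF r]]
      module.axioms(2)[OF module_Lim] module_Lim
    by (auto simp: mod_hom_def hom_def abelian_monoid.a_closed[OF abelian_group.axioms(1)]
        module.smult_closed)
  with eq show ?thesis
    by (intro exI[of _ "restrict (\<iota> r \<circ> lim_leg r) (carrier LimM)"]) (auto simp: induced_morphism_def)
qed

end

end

theory Submission
  imports Defs
begin

text \<open>
  A walk maps the legs of the limit cone to each other, so every morphism of the extended
  representation agrees with \<open>\<phi>\<^sub>M\<close> on the limit, and \<open>\<delta>\<close> imposes no condition on \<open>lim(M)\<close>. Hence all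
  summands are equal to \<open>P(M)\<close>. There is at least one of them unless \<open>G\<close> is empty, because a
  walk of maximal length leads from a source to a sink; on the empty graph both sides are zero.
\<close>

text \<open>\<open>mod_hom\<close> tests functions only on the carrier, and closure of
  \<open>A\<close> under its operations puts sums and multiples there too.\<close>

lemma mod_hom_cong:
  assumes "h \<in> mod_hom K A B" "module K A" "\<And>x. x \<in> carrier A \<Longrightarrow> g x = h x"
  shows "g \<in> mod_hom K A B"
proof -
  interpret module K A by fact
  show ?thesis
    by (rule mod_homI) (simp_all add: assms(3) mod_homD[OF assms(1)])
qed

lemma mod_sum_empty:
  assumes "abelian_monoid A"
  shows "mod_sum A {} = {\<zero>\<^bsub>A\<^esub>}"
  using abelian_monoid.finsum_empty[OF assms] by (auto simp: mod_sum_def)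

text \<open>A finite subfamily of \<open>{U}\<close> is either empty, contributing the zero that
  lies in \<open>U\<close> by assumption, or \<open>{U}\<close> itself, contributing one element of
  \<open>U\<close>.\<close>

lemma mod_sum_singleton:
  assumes "abelian_monoid A" "U \<subseteq> carrier A" "\<zero>\<^bsub>A\<^esub> \<in> U"
  shows "mod_sum A {U} = U"
proof -
  interpret abelian_monoid A by fact
  have single: "finsum A g {U} = g U" if "g U \<in> U" for g
    using that assms(2) by (subst finsum_insert) auto
  show ?thesis
  proof
    show "mod_sum A {U} \<subseteq> U"
      using assms(3) single by (auto simp: mod_sum_def subset_singleton_iff)
    show "U \<subseteq> mod_sum A {U}"
    proof
      fix u assume "u \<in> U"
      with single[of "\<lambda>_. u"] show "u \<in> mod_sum A {U}"
        unfolding mod_sum_def by (intro CollectI exI[of _ "\<lambda>_. u"] exI[of _ "{U}"]) simp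
    qed
  qed
qed

context dag
begin

text \<open>A repeated vertex would cut out a closed subwalk, and every closed walk yields a
  cycle.\<close>

lemma awalk_distinct_verts:
  assumes "awalk u p v"
  shows "distinct (awalk_verts u p)"
proof (rule ccontr)
  assume "\<not> ?thesis"
  then obtain q r s where "closed_w r"
    using awalk_not_distinct_decomp[OF assms] by (auto simp: closed_w_def)
  then show False using closed_w_imp_cycle acyclic by blast
qed

text \<open>The inequality is strict because a walk visits one vertex more than it has arcs.\<close>

lemma awalk_length_less:
  assumes "awalk u p v"
  shows "length p < card (verts G)"
proof -
  have "set (awalk_verts u p) \<subseteq> verts G" using assms by auto
  then have "card (set (awalk_verts u p)) \<le> card (verts G)" by (intro card_mono) auto
  then show ?thesis
    using awalk_distinct_verts[OF assms] by (simp add: distinct_card length_awalk_verts)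
qed

lemma source_sink_awalk:
  assumes "verts G \<noteq> {}"
  obtains s t p where "s \<in> sources G" "t \<in> sinks G" "awalk s p t"
proof -
  let ?walk = "\<lambda>p. \<exists>u v. awalk u p v"
  from assms have "?walk []" by (auto simp: awalk_Nil_iff)
  \<comment> \<open>The trivial walk and the length bound guarantee a maximum.\<close>
  then obtain p where "?walk p" and longest: "\<And>q. ?walk q \<Longrightarrow> length q \<le> length p"
    using ex_has_greatest_nat[of ?walk "[]" length "card (verts G)"] awalk_length_less by blast
  then obtain s t where st: "awalk s p t" by blast
  \<comment> \<open>An arc into \<open>s\<close> could be prepended, and one out of \<open>t\<close>
    appended, contradicting maximality.\<close>
  have "e \<notin> in_arcs G s" for e
    using longest[of "e # p"] st by (auto simp: awalk_Cons_iff)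
  moreover have "e \<notin> out_arcs G t" for e
  proof
    assume "e \<in> out_arcs G t"
    then have "awalk s (p @ [e]) (head G e)"
      using st by (intro awalk_appendI[OF st]) (auto simp: awalk_simps)
    then show False using longest[of "p @ [e]"] by auto
  qed
  ultimately have "s \<in> sources G" "t \<in> sinks G"
    using awalk_hd_in_verts[OF st] awalk_last_in_verts[OF st]
    unfolding sources_def sinks_def by blast+
  with st show thesis by (rule that[rotated 2])
qed

end

context commutative_G_module
begin

lemma path_map_lim_leg:
  assumes "awalk u p v" "x \<in> carrier LimM"
  shows "path_map f p (lim_leg u x) = lim_leg v x"
  using assms by (induction p arbitrary: u) (auto simp: awalk_simps lim_cone)

lemma underline_mod_eq: "underline_mod G W f = carrier LimM"
  by (auto simp: underline_mod_def source_delta_def mod_prod_simps LimM_simps lim_leg_def sources_def)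

lemma carrier_Lim_empty: "verts G = {} \<Longrightarrow> carrier LimM = {\<zero>\<^bsub>LimM\<^esub>}"
  \<comment> \<open>Without vertices there are no arcs either, so the compatibility condition is
    vacuous and the one extensional function on the empty set remains.\<close>
  using wellformed by (auto simp: lim_mod_def mod_prod_def)

lemma induced_morphism_zero:
  assumes "induced_morphism K G W f \<phi>"
  shows "\<phi> \<zero>\<^bsub>LimM\<^esub> = \<zero>\<^bsub>ColimM\<^esub>"
proof -
  have "\<phi> \<in> mod_hom K LimM ColimM" using assms by (simp add: induced_morphism_def)
  then show ?thesis by (rule mod_hom_zero[OF _ module_Lim module_Colim])
qed

text \<open>Any vertex fixes the values through its legs; on the empty graph the limit is zero and
  linearity fixes the only value. This resolves the \<open>THE\<close> in
  \<open>persistence\<close>.\<close>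

lemma induced_morphism_unique:
  assumes "induced_morphism K G W f \<phi>" "induced_morphism K G W f \<psi>"
  shows "\<phi> = \<psi>"
proof (rule extensionalityI[of _ "carrier LimM"])
  fix x assume x: "x \<in> carrier LimM"
  show "\<phi> x = \<psi> x"
  proof (cases "verts G = {}")
    case True
    with x have "x = \<zero>\<^bsub>LimM\<^esub>" by (simp add: carrier_Lim_empty)
    then show ?thesis using assms[THEN induced_morphism_zero] by simp
  next
    case False
    then show ?thesis using assms x by (auto simp: induced_morphism_def)
  qed
qed (use assms in \<open>auto simp: induced_morphism_def\<close>)

lemma persistence_eq:
  assumes "induced_morphism K G W f \<phi>"
  shows "persistence K G W f = \<phi> ` carrier LimM"
  using assms the_equality[of "induced_morphism K G W f" \<phi>] induced_morphism_unique
  unfolding persistence_def by metis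

lemma extended_morphism_eq:
  assumes "induced_morphism K G W f \<phi>" "h \<in> extended_morphisms K G W f" "x \<in> carrier LimM"
  shows "h x = \<phi> x"
proof -
  obtain s t p where "t \<in> sinks G" "awalk s p t" "h = \<iota> t \<circ> path_map f p \<circ> lim_leg s"
    using assms(2) by (auto simp: extended_morphisms_def)
  then show ?thesis
    using assms(1,3) by (auto simp: path_map_lim_leg induced_morphism_def sinks_def)
qed

lemma extended_morphisms_empty_iff: "extended_morphisms K G W f = {} \<longleftrightarrow> verts G = {}"
proof
  assume empty: "extended_morphisms K G W f = {}"
  show "verts G = {}"
  proof (rule ccontr)
    assume "verts G \<noteq> {}"
    then obtain s t p where "s \<in> sources G" "t \<in> sinks G" "awalk s p t"
      by (rule source_sink_awalk)
    then have "\<iota> t \<circ> path_map f p \<circ> lim_leg s \<in> extended_morphisms K G W f"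
      unfolding extended_morphisms_def by blast
    with empty show False by simp
  qed
qed (auto simp: extended_morphisms_def sources_def)

text \<open>Linearity is inherited from \<phi>, with which these composites agree on the
  limit.\<close>

lemma extended_morphisms_subset_mod_hom:
  assumes "induced_morphism K G W f \<phi>"
  shows "extended_morphisms K G W f \<subseteq> mod_hom K LimM ColimM"
  using assms extended_morphism_eq[OF assms] module_Lim
  by (auto simp: induced_morphism_def intro: mod_hom_cong)

lemma persistence_eq_mod_sum:
  assumes "induced_morphism K G W f \<phi>"
  shows "persistence K G W f =
    mod_sum ColimM {h ` underline_mod G W f | h. h \<in> extended_morphisms K G W f}"
proof -
  have \<phi>: "\<phi> \<in> mod_hom K LimM ColimM"
    using assms by (simp add: induced_morphism_def)
  interpret LimM: module K LimM by (rule module_Lim)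
  interpret ColimM: module K ColimM by (rule module_Colim)
  note zero = induced_morphism_zero[OF assms]
  have image: "h ` underline_mod G W f = \<phi> ` carrier LimM" if "h \<in> extended_morphisms K G W f" for h
    unfolding underline_mod_eq using extended_morphism_eq[OF assms that] by (rule image_cong[OF refl])
  show ?thesis
  proof (cases "verts G = {}")
    case True
    then have "extended_morphisms K G W f = {}"
      by (simp only: extended_morphisms_empty_iff)
    with True show ?thesis
      by (simp add: persistence_eq[OF assms] carrier_Lim_empty zero mod_sum_empty[OF ColimM.abelian_monoid_axioms])
  next
    case False
    \<comment> \<open>The summands form a set, so equal images collapse to one; a vertex ensures
      that there is one.\<close>
    then have "{h ` underline_mod G W f | h. h \<in> extended_morphisms K G W f} = {\<phi> ` carrier LimM}"
      using image extended_morphisms_empty_iff by blast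
    moreover have "mod_sum ColimM {\<phi> ` carrier LimM} = \<phi> ` carrier LimM"
    proof (rule mod_sum_singleton)
      show "\<phi> ` carrier LimM \<subseteq> carrier ColimM" using mod_homD(1)[OF \<phi>] by blast
      \<comment> \<open>This is the value of \<phi> at the zero family.\<close>
      show "\<zero>\<^bsub>ColimM\<^esub> \<in> \<phi> ` carrier LimM"
        using zero LimM.zero_closed by (metis imageI)
    qed unfold_locales
    ultimately show ?thesis by (simp add: persistence_eq[OF assms])
  qed
qed

end

theorem proposition4p3:
  fixes K :: "('k, 'c) ring_scheme" and G :: "('v, 'e) pre_digraph"
    and W :: "'v \<Rightarrow> ('k, 'w) module" and f :: "'e \<Rightarrow> 'w \<Rightarrow> 'w"
  assumes "commutative_G_module K G W f"
    and "\<exists>\<phi>. induced_morphism K G W f \<phi>"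
  shows "persistence K G W f =
      alpha K (extended_morphisms K G W f) (lim_mod G W f) (underline_mod G W f) (colim_mod K G W f)
    \<and> alpha K (extended_morphisms K G W f) (lim_mod G W f) (underline_mod G W f) (colim_mod K G W f) =
      mod_sum (colim_mod K G W f) {h ` underline_mod G W f | h. h \<in> extended_morphisms K G W f}"
proof -
  interpret commutative_G_module K G W f by fact
  obtain \<phi> where \<phi>: "induced_morphism K G W f \<phi>" using assms(2) by blast
  have "mod_hom K LimM ColimM \<inter> extended_morphisms K G W f = extended_morphisms K G W f"
    using extended_morphisms_subset_mod_hom[OF \<phi>] by blast
  then show ?thesis
    by (simp only: alpha_def persistence_eq_mod_sum[OF \<phi>] simp_thms)
qed

end
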